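(* Let $n\ge 1$, let $A$ be an $n\times n$ complex matrix, and write $\det(A-\lambda I)=\sum_{i=0}^n c_i\lambda^i$. When the anti-symmetrizer in the closed-up diagram $$\mathrm{ptr}\Big(\mathrm{Alt}_{n+1}\circ\big(\mathrm{id}_V\otimes A^{\otimes n}\big)\Big)$$ is expanded as a sum over permutations, yielding a formal expression $\sum_{i=0}^n \kappa_i A^i$, the coefficient $\kappa_i$ of $A^i$ satisfies $$\kappa_i = n!\,c_i\qquad\text{for every } 0\le i\le n .$$ Here $$\kappa_i=\sum_{\sigma}\ \mathrm{sgn}(\sigma)\prod_{c}\mathrm{tr}\big(A^{|c|}\big),$$ where $\sigma$ runs over the permutations in $\Sigma_{n+1}$ whose cycle containing $1$ has length $i+1$, and $c$ runs over the remaining cycles of $\sigma$ (including fixed points), with $|c|$ the length of $c$.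
   Context: $V=\mathbb{C}^n$. For $m\ge 0$, the anti-symmetrizer $\mathrm{Alt}_m:V^{\otimes m}\to V^{\otimes m}$ is the (unnormalized) linear map $a_1\otimes\cdots\otimes a_m\mapsto \sum_{\sigma\in\Sigma_m}\mathrm{sgn}(\sigma)\,a_{\sigma(1)}\otimes\cdots\otimes a_{\sigma(m)}$, where $\Sigma_m$ is the symmetric group on $m$ letters. For a linear map $F:V^{\otimes(k+1)}\to V^{\otimes(k+1)}$, $\mathrm{ptr}(F):V\to V$ denotes the partial trace over the last $k$ tensor factors, i.e. the map obtained by closing up the last $k$ strands of the diagram of $F$ into loops and leaving the first strand open. In the expansion, each $\sigma\in\Sigma_{n+1}$ contributes the map $V\to V$ equal to $\mathrm{sgn}(\sigma)\left(\prod_c \mathrm{tr}(A^{|c|})\right)A^{i}$, where $i+1$ is the length of the cycle of $\sigma$ containing $1$ and $c$ runs over the other cycles; the terms are grouped according to the power $A^i$. *)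

theory Defs
  imports "HOL-Analysis.Analysis" "HOL-Combinatorics.Orbits"
begin

text \<open>
  \<open>V = complex ^ 'n\<close>.  Tensors in the \<open>m\<close>-th tensor power of \<open>V\<close> are represented by their
  coordinates in the standard basis: a multi-index is an extensional function
  \<open>f \<in> {1..m} \<rightarrow>\<^sub>E UNIV\<close>, where \<open>f k\<close> is the basis index in the \<open>k\<close>-th tensor factor,
  and a tensor vanishes on all functions that are not multi-indices.
\<close>

type_synonym 'n tensor = "(nat \<Rightarrow> 'n) \<Rightarrow> complex"

definition multi_indices :: "nat \<Rightarrow> (nat \<Rightarrow> 'n) set" where
  "multi_indices m = {1..m} \<rightarrow>\<^sub>E UNIV"

text \<open>The pure tensor \<open>a 1 \<otimes> \<dots> \<otimes> a m\<close>.\<close>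

definition pure_tensor :: "nat \<Rightarrow> (nat \<Rightarrow> complex ^ 'n) \<Rightarrow> 'n tensor" where
  "pure_tensor m a = (\<lambda>f. if f \<in> multi_indices m then \<Prod>k=1..m. a k $ f k else 0)"

text \<open>
  \<open>permute_tensor \<sigma>\<close> sends \<open>a 1 \<otimes> \<dots> \<otimes> a m\<close> to \<open>a (\<sigma> 1) \<otimes> \<dots> \<otimes> a (\<sigma> m)\<close>
  (lemma \<open>permute_tensor_pure\<close>), which in coordinates is precomposition with \<open>inv \<sigma>\<close>.
\<close>

definition permute_tensor :: "(nat \<Rightarrow> nat) \<Rightarrow> 'n tensor \<Rightarrow> 'n tensor" where
  "permute_tensor \<sigma> T = (\<lambda>f. T (f \<circ> inv \<sigma>))"

definition Alt :: "nat \<Rightarrow> 'n tensor \<Rightarrow> 'n tensor" where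
  "Alt m T = (\<lambda>f. \<Sum>\<sigma> | \<sigma> permutes {1..m}. of_int (sign \<sigma>) * permute_tensor \<sigma> T f)"

text \<open>The tensor product \<open>B 1 \<otimes> \<dots> \<otimes> B m\<close> of endomorphisms of \<open>V\<close>.\<close>

definition tensor_map :: "nat \<Rightarrow> (nat \<Rightarrow> complex ^ 'n ^ 'n) \<Rightarrow> 'n::finite tensor \<Rightarrow> 'n tensor" where
  "tensor_map m B T = (\<lambda>f. if f \<in> multi_indices m
     then \<Sum>g\<in>multi_indices m. (\<Prod>k=1..m. B k $ f k $ g k) * T g else 0)"

text \<open>\<open>id \<otimes> A \<otimes> \<dots> \<otimes> A\<close> with \<open>n = dim V\<close> copies of \<open>A\<close>.\<close>

definition id_tensor_power :: "complex ^ 'n ^ 'n \<Rightarrow> 'n::finite tensor \<Rightarrow> 'n tensor" where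
  "id_tensor_power A = tensor_map (CARD('n)+1) (\<lambda>k. if k = 1 then mat 1 else A)"

text \<open>
  Partial trace over the last \<open>k\<close> of \<open>k + 1\<close> tensor factors: the \<open>i\<close>-th coordinate of \<open>ptr k F v\<close>
  is the sum over all \<open>k\<close>-tuples \<open>e\<close> of basis vectors (in factors \<open>2, \<dots>, k + 1\<close>) of the
  \<open>(i, e)\<close>-coordinate of \<open>F (v \<otimes> e)\<close>.
\<close>

definition ptr :: "nat \<Rightarrow> ('n tensor \<Rightarrow> 'n tensor) \<Rightarrow> complex ^ 'n \<Rightarrow> complex ^ 'n::finite" where
  "ptr k F v = (\<chi> i. \<Sum>g\<in>{2..k+1} \<rightarrow>\<^sub>E UNIV.
     F (pure_tensor (k+1) (\<lambda>j. if j = 1 then v else axis (g j) 1)) (g(1 := i)))"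

text \<open>Powers in the matrix ring; the type class power of \<open>complex ^ 'n ^ 'n\<close> is componentwise.\<close>

definition matrix_power :: "complex ^ 'n ^ 'n \<Rightarrow> nat \<Rightarrow> complex ^ 'n ^ 'n::finite" where
  "matrix_power A k = (((**) A) ^^ k) (mat 1)"

text \<open>
  The cycles of a permutation of \<open>{1..m}\<close> other than the one containing \<open>1\<close>, as sets; fixed points
  are included as singletons.
\<close>

definition other_cycles :: "nat \<Rightarrow> (nat \<Rightarrow> nat) \<Rightarrow> nat set set" where
  "other_cycles m \<sigma> = orbit \<sigma> ` {1..m} - {orbit \<sigma> 1}"

definition kappa :: "complex ^ 'n ^ 'n \<Rightarrow> nat \<Rightarrow> complex" where
  "kappa A i = (\<Sum>\<sigma> | \<sigma> permutes {1..CARD('n)+1} \<and> card (orbit \<sigma> 1) = i + 1.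
     of_int (sign \<sigma>) * (\<Prod>c\<in>other_cycles (CARD('n)+1) \<sigma>. trace (matrix_power A (card c))))"

lemma comp_inv_multi_indices_iff:
  assumes "\<sigma> permutes {1..m}"
  shows "f \<circ> inv \<sigma> \<in> multi_indices m \<longleftrightarrow> f \<in> multi_indices m"
proof -
  have fix1: "inv \<sigma> k = k" if "k \<notin> {1..m}" for k
    using permutes_not_in[OF permutes_inv[OF assms] that] .
  have "f \<circ> inv \<sigma> \<in> multi_indices m \<longleftrightarrow> (\<forall>k. k \<notin> {1..m} \<longrightarrow> f (inv \<sigma> k) = undefined)"
    by (auto simp: multi_indices_def PiE_iff extensional_def)
  also have "\<dots> \<longleftrightarrow> (\<forall>k. k \<notin> {1..m} \<longrightarrow> f k = undefined)"
    using fix1 by auto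
  also have "\<dots> \<longleftrightarrow> f \<in> multi_indices m"
    by (auto simp: multi_indices_def PiE_iff extensional_def)
  finally show ?thesis .
qed

lemma permute_tensor_pure:
  assumes "\<sigma> permutes {1..m}"
  shows "permute_tensor \<sigma> (pure_tensor m a) = pure_tensor m (\<lambda>k. a (\<sigma> k))"
proof
  fix f
  have "(\<Prod>k=1..m. a k $ f (inv \<sigma> k)) = (\<Prod>k=1..m. a (\<sigma> k) $ f (inv \<sigma> (\<sigma> k)))"
    using prod.permute[OF assms, of "\<lambda>k. a k $ f (inv \<sigma> k)"] by (simp add: o_def)
  also have "\<dots> = (\<Prod>k=1..m. a (\<sigma> k) $ f k)"
    by (simp add: permutes_inverses(2)[OF assms])
  finally show "permute_tensor \<sigma> (pure_tensor m a) f = pure_tensor m (\<lambda>k. a (\<sigma> k)) f"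
    by (simp add: permute_tensor_def pure_tensor_def comp_inv_multi_indices_iff[OF assms])
qed

lemma Alt_pure:
  "Alt m (pure_tensor m a) =
     (\<lambda>f. \<Sum>\<sigma> | \<sigma> permutes {1..m}. of_int (sign \<sigma>) * pure_tensor m (\<lambda>k. a (\<sigma> k)) f)"
  by (simp add: Alt_def permute_tensor_pure)

lemma tensor_map_pure:
  "tensor_map m B (pure_tensor m a) = pure_tensor m (\<lambda>k. B k *v a k)"
proof
  fix f
  have "(\<Sum>g\<in>multi_indices m. (\<Prod>k=1..m. B k $ f k $ g k) * pure_tensor m a g)
      = (\<Sum>g\<in>{1..m} \<rightarrow>\<^sub>E UNIV. \<Prod>k=1..m. B k $ f k $ g k * a k $ g k)"
    by (simp add: pure_tensor_def prod.distrib multi_indices_def)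
  also have "\<dots> = (\<Prod>k=1..m. (B k *v a k) $ f k)"
    by (simp add: prod_sum_PiE matrix_vector_mult_def)
  finally show "tensor_map m B (pure_tensor m a) f = pure_tensor m (\<lambda>k. B k *v a k) f"
    by (simp add: tensor_map_def pure_tensor_def)
qed

end

theory Submission
  imports Defs
begin

text \<open>
  Removing \<open>a\<close> from its cycle turns a permutation \<open>\<sigma>\<close> with \<open>\<sigma> a = b \<noteq> a\<close> into a permutation \<open>\<rho>\<close> of the
  remaining points, with \<open>\<sigma> = (a b) \<circ> \<rho>\<close>; the sign flips, the cycle of \<open>b\<close> is one shorter than that
  of \<open>a\<close>, and the other cycles do not change.  In the diagram of \<open>\<sigma>\<close> this strips one factor \<open>A\<close> off
  the open strand, which gives the contribution of \<open>\<sigma>\<close> by induction.  In the definition of the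
  coefficients it gives \<open>\<kappa>\<^sub>i(m) = - m \<kappa>\<^sub>i\<^sub>-\<^sub>1(m - 1)\<close> for the analogue \<open>\<kappa>\<^sub>i(m)\<close> of \<open>\<kappa>\<^sub>i\<close> over permutations
  of \<open>m + 1\<close> letters, so \<open>\<kappa>\<^sub>i = (-1)\<^sup>i (n! / (n - i)!) \<kappa>\<^sub>0(n - i)\<close>.  Finally \<open>\<kappa>\<^sub>0(m)\<close>, the signed sum
  of all products of traces over permutations of \<open>m\<close> letters, is \<open>m!\<close> times the sum of the principal
  \<open>m \<times> m\<close> minors of \<open>A\<close>, and these sums are up to sign the coefficients of \<open>det (A - \<lambda>I)\<close>.
\<close>

section \<open>Sums over extensional functions, and matrix powers\<close>

lemma sum_PiE_insert:
  fixes F :: "('a \<Rightarrow> 'b) \<Rightarrow> 'c::comm_monoid_add"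
  assumes "x \<notin> S"
  shows "(\<Sum>f\<in>insert x S \<rightarrow>\<^sub>E T. F f) = (\<Sum>y\<in>T. \<Sum>g\<in>S \<rightarrow>\<^sub>E T. F (g(x := y)))"
proof -
  have "(\<Sum>f\<in>insert x S \<rightarrow>\<^sub>E T. F f) = (\<Sum>(y, g)\<in>T \<times> (S \<rightarrow>\<^sub>E T). F (g(x := y)))"
    unfolding PiE_insert_eq
    by (subst sum.reindex) (use inj_combinator[OF assms, of "\<lambda>_. T"] in \<open>auto simp: case_prod_unfold\<close>)
  then show ?thesis
    by (simp add: sum.cartesian_product)
qed

lemma matrix_power_0 [simp]: "matrix_power A 0 = mat 1"
  by (simp add: matrix_power_def)

lemma matrix_power_Suc: "matrix_power A (Suc k) = A ** matrix_power A k"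
  by (simp add: matrix_power_def)

lemma matrix_power_Suc_right: "matrix_power A (Suc k) = matrix_power A k ** A"
proof (induction k)
  case 0
  then show ?case by (simp add: matrix_power_Suc)
next
  case (Suc k)
  then show ?case
    by (metis matrix_mul_assoc matrix_power_Suc)
qed

section \<open>Removing a point from its cycle\<close>

text \<open>Since \<open>\<rho>\<close> fixes \<open>a\<close>, composing with the transposition
  redirects the arrow of \<open>\<rho>\<close> into \<open>b\<close> to \<open>a\<close> and then
  sends \<open>a\<close> to \<open>b\<close>: the point \<open>a\<close> is inserted just before
  \<open>b\<close>.\<close>

context
  fixes S :: "'a set" and a b :: 'a and \<rho> :: "'a \<Rightarrow> 'a"
  assumes \<rho>: "\<rho> permutes S" and fin: "finite S" and a: "a \<notin> S" and b: "b \<in> S"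
begin

lemma transpose_comp_permutes_insert: "Transposition.transpose a b \<circ> \<rho> permutes insert a S"
  using permutes_subset[OF \<rho>, of "insert a S"] permutes_swap_id[of a "insert a S" b] b
  by (auto intro: permutes_compose)

lemma transpose_comp_self: "(Transposition.transpose a b \<circ> \<rho>) a = b"
  using permutes_not_in[OF \<rho> a] by simp

lemma transpose_comp_eq_iff: "x \<in> S \<Longrightarrow> (Transposition.transpose a b \<circ> \<rho>) x = a \<longleftrightarrow> \<rho> x = b"
  using permutes_in_image[OF \<rho>, of x] a by (auto simp: Transposition.transpose_def)

lemma transpose_comp_other:
  "x \<in> S \<Longrightarrow> \<rho> x \<noteq> b \<Longrightarrow> (Transposition.transpose a b \<circ> \<rho>) x = \<rho> x"
  using permutes_in_image[OF \<rho>, of x] a by (auto simp: Transposition.transpose_def)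

lemma permutation_contracted: "permutation \<rho>" "permutation (Transposition.transpose a b \<circ> \<rho>)"
  using \<rho> transpose_comp_permutes_insert fin permutation_permutes by blast+

lemma orbit_transpose_comp_self:
  "orbit (Transposition.transpose a b \<circ> \<rho>) a = insert a (orbit \<rho> b)" (is "orbit ?\<sigma> a = _")
proof (intro set_eqI iffI)
  note sub = permutes_orbit_subset[OF \<rho> b]
  fix x assume "x \<in> orbit ?\<sigma> a"
  then show "x \<in> insert a (orbit \<rho> b)"
  proof induction
    case base
    then show ?case
      using transpose_comp_self permutation_self_in_orbit[OF permutation_contracted(1)] by simp
  next
    case (step y)
    then consider "y = a" | "y \<in> orbit \<rho> b" "\<rho> y = b" | "y \<in> orbit \<rho> b" "\<rho> y \<noteq> b"
      by auto
    then show ?case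
    proof cases
      case 1
      then show ?thesis
        using transpose_comp_self permutation_self_in_orbit[OF permutation_contracted(1)] by simp
    next
      case 2
      then show ?thesis
        using transpose_comp_eq_iff sub by auto
    next
      case 3
      then have "?\<sigma> y = \<rho> y"
        using transpose_comp_other sub by blast
      with 3 show ?thesis
        by (metis insertCI orbit.step)
    qed
  qed
next
  note sub = permutes_orbit_subset[OF \<rho> b]
  fix x assume "x \<in> insert a (orbit \<rho> b)"
  moreover have "a \<in> orbit ?\<sigma> a"
    by (rule permutation_self_in_orbit[OF permutation_contracted(2)])
  moreover have bin: "b \<in> orbit ?\<sigma> a"
    using orbit.base[of ?\<sigma> a] transpose_comp_self by simp
  moreover have "x \<in> orbit ?\<sigma> a" if "x \<in> orbit \<rho> b"
  proof -
    \<comment> \<open>Only the arrow into \<open>b\<close> was redirected, and its old target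
      \<open>b\<close> already lies in the new orbit.\<close>
    have \<rho>_step: "\<rho> y \<in> orbit ?\<sigma> a" if "y \<in> orbit ?\<sigma> a" "y \<in> S" for y
      using that transpose_comp_other[of y] bin orbit.step[of y ?\<sigma> a] by (cases "\<rho> y = b") auto
    from that show ?thesis
    proof induction
      case base
      then show ?case by (rule \<rho>_step[OF bin b])
    next
      case (step y)
      then show ?case using sub \<rho>_step by blast
    qed
  qed
  ultimately show "x \<in> orbit ?\<sigma> a"
    by auto
qed

lemma card_orbit_transpose_comp_self:
  "card (orbit (Transposition.transpose a b \<circ> \<rho>) a) = Suc (card (orbit \<rho> b))"
proof -
  have "a \<notin> orbit \<rho> b" "finite (orbit \<rho> b)"
    using permutes_orbit_subset[OF \<rho> b] a fin finite_subset by auto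
  then show ?thesis
    by (simp add: orbit_transpose_comp_self)
qed

text \<open>The two permutations differ only at \<open>a\<close> and at the preimage of
  \<open>b\<close> under \<open>\<rho>\<close>; an orbit of \<open>\<rho>\<close> in
  \<open>S\<close> that avoids \<open>b\<close> meets neither.\<close>

lemma orbit_transpose_comp_other:
  assumes x: "x \<in> S" "x \<notin> orbit \<rho> b"
  shows "orbit (Transposition.transpose a b \<circ> \<rho>) x = orbit \<rho> x" (is "orbit ?\<sigma> x = _")
proof -
  have "b \<notin> orbit \<rho> x"
    using x permutation_self_in_orbit[OF permutation_contracted(1)] orbit_swap by metis
  then have eq: "?\<sigma> y = \<rho> y" if "y \<in> orbit \<rho> x" for y
    using that transpose_comp_other[of y] permutes_orbit_subset[OF \<rho> x(1)] orbit.step[of y \<rho> x] by auto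
  then show ?thesis
    by (intro orbit_cong permutation_self_in_orbit permutation_contracted)
qed

text \<open>Orbits of permutations coincide or are disjoint, so discarding the marked orbit leaves
  on both sides the orbits of the points of \<open>S\<close> outside
  \<open>orbit \<rho> b\<close>.\<close>

lemma other_orbits_transpose_comp:
  "orbit (Transposition.transpose a b \<circ> \<rho>) ` insert a S - {orbit (Transposition.transpose a b \<circ> \<rho>) a}
    = orbit \<rho> ` S - {orbit \<rho> b}" (is "orbit ?\<sigma> ` _ - _ = _")
proof -
  have mem: "x \<in> orbit \<rho> x" "x \<in> orbit ?\<sigma> x" for x
    using permutation_contracted permutation_self_in_orbit by metis+
  have \<rho>_eq: "orbit \<rho> x = orbit \<rho> b \<longleftrightarrow> x \<in> orbit \<rho> b" for x
    using mem(1) by (metis orbit_swap orbit_trans subsetI subset_antisym)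
  have \<sigma>_eq: "orbit ?\<sigma> x = orbit ?\<sigma> a \<longleftrightarrow> x \<in> orbit ?\<sigma> a" for x
    using mem(2) by (metis orbit_swap orbit_trans subsetI subset_antisym)
  have "orbit ?\<sigma> ` insert a S - {orbit ?\<sigma> a} = orbit ?\<sigma> ` {x \<in> S. x \<notin> orbit \<rho> b}"
    using \<sigma>_eq a by (auto simp: orbit_transpose_comp_self)
  also have "\<dots> = orbit \<rho> ` {x \<in> S. x \<notin> orbit \<rho> b}"
    by (rule image_cong) (auto simp: orbit_transpose_comp_other)
  also have "\<dots> = orbit \<rho> ` S - {orbit \<rho> b}"
    using \<rho>_eq by auto
  finally show ?thesis .
qed

lemma sign_transpose_comp: "sign (Transposition.transpose a b \<circ> \<rho>) = - sign \<rho>"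
proof -
  have "a \<noteq> b" using a b by auto
  then show ?thesis
    using permutation_contracted(1) by (simp add: sign_compose permutation_swap_id sign_swap_id)
qed

end

lemma other_orbits_fixed:
  assumes \<sigma>: "\<sigma> permutes S" and a: "a \<notin> S"
  shows "orbit \<sigma> ` insert a S - {orbit \<sigma> a} = orbit \<sigma> ` S"
proof -
  have "orbit \<sigma> a = {a}"
    using permutes_not_in[OF \<sigma> a] by (simp add: orbit_eq_singleton_iff)
  moreover have "a \<notin> orbit \<sigma> x" if "x \<in> S" for x
    using permutes_orbit_subset[OF \<sigma> that] a by auto
  ultimately show ?thesis
    by force
qed

section \<open>Evaluating the diagram of a permutation\<close>

text \<open>
  The diagram of \<open>\<sigma>\<close> on the points \<open>insert a S\<close>: the strand at \<open>a\<close> is open with output index \<open>i\<close>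
  and input vector \<open>v\<close>, and the indices at the points of \<open>S\<close> are summed over.
\<close>

definition walk_sum ::
    "complex ^ 'n ^ 'n \<Rightarrow> ('a \<Rightarrow> 'a) \<Rightarrow> 'a set \<Rightarrow> 'a \<Rightarrow> complex ^ 'n \<Rightarrow> 'n \<Rightarrow> complex" where
  "walk_sum A \<sigma> S a v i = (\<Sum>g\<in>S \<rightarrow>\<^sub>E UNIV. \<Prod>k\<in>insert a S.
     if \<sigma> k = a then v $ (g(a := i)) k else A $ (g(a := i)) k $ (g(a := i)) (\<sigma> k))"

text \<open>Closes the open strand: column \<open>i\<close> of \<open>A\<close> as input and
  \<open>i\<close> as output index supply the missing factor \<open>A\<close>, and the sum over
  \<open>i\<close> is a trace. Assumption \<open>walk\<close> is the conclusion of
  \<open>walk_sum_eq\<close> for this \<open>S\<close>, \<open>a\<close> and \<open>\<sigma>\<close>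
  alone, so that the lemma can serve inside the induction proving it.\<close>

lemma sum_closed_walks:
  fixes A :: "complex ^ 'n ^ 'n"
  assumes "finite S" "a \<notin> S" "\<sigma> permutes insert a S"
    and walk: "\<And>i v. walk_sum A \<sigma> S a v i =
      (\<Prod>c\<in>orbit \<sigma> ` insert a S - {orbit \<sigma> a}. trace (matrix_power A (card c)))
        * (matrix_power A (card (orbit \<sigma> a) - 1) *v v) $ i"
  shows "(\<Sum>g\<in>insert a S \<rightarrow>\<^sub>E UNIV. \<Prod>k\<in>insert a S. A $ g k $ g (\<sigma> k)) =
    (\<Prod>c\<in>orbit \<sigma> ` insert a S. trace (matrix_power A (card c)))"
proof -
  define P where "P = (\<Prod>c\<in>orbit \<sigma> ` insert a S - {orbit \<sigma> a}. trace (matrix_power A (card c)))"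
  define l where "l = card (orbit \<sigma> a) - 1"
  have perm: "permutation \<sigma>"
    using assms(1,3) permutation_permutes by blast
  have l: "card (orbit \<sigma> a) = Suc l"
    using finite_orbit[OF permutation_self_in_orbit[OF perm], of a] orbit_nonempty[of \<sigma> a]
    by (simp add: l_def card_gt_0_iff)
  have "(\<Sum>g\<in>insert a S \<rightarrow>\<^sub>E UNIV. \<Prod>k\<in>insert a S. A $ g k $ g (\<sigma> k)) =
      (\<Sum>i\<in>UNIV. walk_sum A \<sigma> S a (column i A) i)"
    unfolding sum_PiE_insert[OF assms(2)] walk_sum_def
    by (intro sum.cong prod.cong) (auto simp: column_def)
  also have "\<dots> = P * (\<Sum>i\<in>UNIV. (matrix_power A l *v column i A) $ i)"
    by (simp add: walk P_def l_def sum_distrib_left)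
  also have "(\<Sum>i\<in>UNIV. (matrix_power A l *v column i A) $ i) = trace (matrix_power A (Suc l))"
    by (simp add: trace_def matrix_power_Suc_right matrix_matrix_mult_def matrix_vector_mult_def
        column_def)
  also have "P * trace (matrix_power A (Suc l)) =
      (\<Prod>c\<in>orbit \<sigma> ` insert a S. trace (matrix_power A (card c)))"
    unfolding P_def l[symmetric] using assms(1)
    by (subst (2) prod.remove[of _ "orbit \<sigma> a"]) (auto simp: mult.commute)
  finally show ?thesis .
qed

text \<open>Induction on the size of \<open>S\<close>. A fixed \<open>a\<close> splits off the
  scalar \<open>v $ i\<close> and leaves a closed diagram; otherwise contracting \<open>a\<close>
  strips off one \<open>A\<close>, and \<open>b\<close> becomes the open point.\<close>

lemma walk_sum_eq:
  fixes A :: "complex ^ 'n ^ 'n"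
  assumes "finite S" "a \<notin> S" "\<sigma> permutes insert a S"
  shows "walk_sum A \<sigma> S a v i =
    (\<Prod>c\<in>orbit \<sigma> ` insert a S - {orbit \<sigma> a}. trace (matrix_power A (card c)))
      * (matrix_power A (card (orbit \<sigma> a) - 1) *v v) $ i"
  using assms
proof (induction "card S" arbitrary: S a \<sigma> v i rule: less_induct)
  case less
  have "\<sigma> \<in> {p. p permutes insert a S}"
    using less.prems by simp
  then obtain b \<rho> where \<sigma>: "\<sigma> = Transposition.transpose a b \<circ> \<rho>" "b \<in> insert a S" and \<rho>: "\<rho> permutes S"
    unfolding permutes_insert by auto
  show ?case
  proof (cases "b = a")
    case True
    then have \<sigma>S: "\<sigma> permutes S"
      using \<sigma> \<rho> by simp
    have \<sigma>a: "\<sigma> a = a" and "orbit \<sigma> a = {a}"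
      using permutes_not_in[OF \<sigma>S less.prems(2)] by (simp_all add: orbit_eq_singleton_iff)
    have \<sigma>k: "\<sigma> k \<in> S" "\<sigma> k \<noteq> a" "k \<noteq> a" if "k \<in> S" for k
      using permutes_in_image[OF \<sigma>S] that less.prems(2) by auto
    have "walk_sum A \<sigma> S a v i = v $ i * (\<Sum>g\<in>S \<rightarrow>\<^sub>E UNIV. \<Prod>k\<in>S. A $ g k $ g (\<sigma> k))"
      unfolding walk_sum_def sum_distrib_left using less.prems \<sigma>a \<sigma>k
      by (intro sum.cong refl) (simp cong: prod.cong)
    also have "(\<Sum>g\<in>S \<rightarrow>\<^sub>E UNIV. \<Prod>k\<in>S. A $ g k $ g (\<sigma> k)) =
        (\<Prod>c\<in>orbit \<sigma> ` S. trace (matrix_power A (card c)))"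
    \<comment> \<open>The closed diagram is cut open at an arbitrary \<open>x\<close> in
      \<open>S\<close>; the rest of \<open>S\<close> is smaller, so the induction hypothesis
      supplies the assumption \<open>walk\<close>.\<close>
    proof (cases "S = {}")
      case False
      then obtain x S' where S: "S = insert x S'" "x \<notin> S'"
        by (meson mk_disjoint_insert ex_in_conv)
      then show ?thesis
        using sum_closed_walks[of S' x \<sigma> A] less.hyps[of S' x \<sigma>] less.prems(1) \<sigma>S by simp
    qed simp
    finally show ?thesis
      using other_orbits_fixed[OF \<sigma>S less.prems(2)] \<open>orbit \<sigma> a = {a}\<close>
      by (simp add: mult.commute)
  next
    case False
    then have b: "b \<in> S"
      using \<sigma> by simp
    then obtain S' where S: "S = insert b S'" "b \<notin> S'"
      by (meson mk_disjoint_insert)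
    note contract = \<rho> less.prems(1,2) b
    have \<sigma>a: "\<sigma> a = b"
      using transpose_comp_self[OF contract] \<sigma>(1) by simp
    \<comment> \<open>At points of \<open>S\<close> the factors of \<open>\<sigma>\<close> are those
      of \<open>\<rho>\<close>, with arrival at \<open>b\<close> in the role of arrival at
      \<open>a\<close>.\<close>
    have eq: "(if \<sigma> k = a then v $ (h(a := i)) k else A $ (h(a := i)) k $ (h(a := i)) (\<sigma> k)) =
        (if \<rho> k = b then v $ h k else A $ h k $ h (\<rho> k))" if "k \<in> S" for h k
      using that transpose_comp_eq_iff[OF contract that] transpose_comp_other[OF contract that]
        permutes_in_image[OF \<rho>, of k] less.prems(2) by (auto simp: \<sigma>(1))
    have "walk_sum A \<sigma> S a v i = (\<Sum>j\<in>UNIV. \<Sum>g\<in>S' \<rightarrow>\<^sub>E UNIV. \<Prod>k\<in>insert a S.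
        if \<sigma> k = a then v $ (g(b := j, a := i)) k
        else A $ (g(b := j, a := i)) k $ (g(b := j, a := i)) (\<sigma> k))"
      unfolding walk_sum_def by (subst S(1), subst sum_PiE_insert[OF S(2)]) simp
    also have "\<dots> = (\<Sum>j\<in>UNIV. A $ i $ j * walk_sum A \<rho> S' b v j)"
      unfolding walk_sum_def sum_distrib_left S(1)[symmetric]
      using less.prems False \<sigma>a by (intro sum.cong refl) (simp add: eq cong: prod.cong)
    also have "\<dots> = (\<Sum>j\<in>UNIV. A $ i $ j *
        ((\<Prod>c\<in>orbit \<rho> ` S - {orbit \<rho> b}. trace (matrix_power A (card c)))
          * (matrix_power A (card (orbit \<rho> b) - 1) *v v) $ j))"
      using less.hyps[of S' b \<rho>] less.prems \<rho> S by simp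
    also have "\<dots> = (\<Prod>c\<in>orbit \<rho> ` S - {orbit \<rho> b}. trace (matrix_power A (card c)))
          * (matrix_power A (Suc (card (orbit \<rho> b) - 1)) *v v) $ i"
      unfolding matrix_power_Suc matrix_vector_mul_assoc[symmetric]
      by (subst (2) matrix_vector_mult_def) (simp add: sum_distrib_left mult_ac)
    also have "Suc (card (orbit \<rho> b) - 1) = card (orbit \<sigma> a) - 1"
    proof -
      have "finite (orbit \<rho> b)"
        using permutes_orbit_subset[OF \<rho> b] less.prems(1) finite_subset by blast
      then have "card (orbit \<rho> b) > 0"
        using orbit_nonempty[of \<rho> b] by (simp add: card_gt_0_iff)
      then show ?thesis
        using card_orbit_transpose_comp_self[OF contract] \<sigma>(1) by simp
    qed
    finally show ?thesis
      unfolding other_orbits_transpose_comp[OF contract, folded \<sigma>(1)] .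
  qed
qed

lemma sum_prod_permutation:
  fixes A :: "complex ^ 'n ^ 'n"
  assumes "finite S" "\<sigma> permutes S"
  shows "(\<Sum>g\<in>S \<rightarrow>\<^sub>E UNIV. \<Prod>k\<in>S. A $ g k $ g (\<sigma> k)) =
    (\<Prod>c\<in>orbit \<sigma> ` S. trace (matrix_power A (card c)))"
proof (cases "S = {}")
  case False
  then obtain x S' where S: "S = insert x S'" "x \<notin> S'"
    by (meson mk_disjoint_insert ex_in_conv)
  then show ?thesis
    using sum_closed_walks[of S' x \<sigma> A] walk_sum_eq[of S' x \<sigma> A] assms by simp
qed simp

section \<open>Principal minors and the characteristic polynomial\<close>

definition principal_minor :: "complex ^ 'n ^ 'n \<Rightarrow> 'n set \<Rightarrow> complex" where
  "principal_minor A W = (\<Sum>\<sigma> | \<sigma> permutes W. of_int (sign \<sigma>) * (\<Prod>k\<in>W. A $ k $ \<sigma> k))"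

text \<open>This is the trace of the \<open>m\<close>-th exterior power of \<open>A\<close>,
  equivalently the \<open>m\<close>-th elementary symmetric polynomial in its eigenvalues.\<close>

definition minor_sum :: "complex ^ 'n ^ 'n \<Rightarrow> nat \<Rightarrow> complex" where
  "minor_sum A m = (\<Sum>W | card W = m. principal_minor A W)"

text \<open>Multiplying out the Leibniz formula, let \<open>X\<close> be the set of rows where
  \<open>- mat x\<close> is chosen. Since \<open>mat x\<close> is diagonal, only permutations fixing
  \<open>X\<close> pointwise can contribute, which leaves the minor on the complement.\<close>

lemma det_sub_mat:
  fixes A :: "complex ^ 'n ^ 'n"
  shows "det (A - mat x) = (\<Sum>i\<le>CARD('n). (- 1) ^ i * minor_sum A (CARD('n) - i) * x ^ i)"
proof -
  have inner: "(\<Sum>\<sigma> | \<sigma> permutes UNIV. of_int (sign \<sigma>) * ((- 1) ^ card X *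
        (\<Prod>k\<in>X. (mat x :: complex ^ 'n ^ 'n) $ k $ \<sigma> k) * (\<Prod>k\<in>UNIV - X. A $ k $ \<sigma> k))) =
      (- x) ^ card X * principal_minor A (- X)" (is "sum ?F _ = _") for X :: "'n set"
  proof -
    have "sum ?F {\<sigma>. \<sigma> permutes UNIV} = sum ?F {\<sigma>. \<sigma> permutes - X}"
    proof (rule sum.mono_neutral_right)
      show "\<forall>\<sigma>\<in>{\<sigma>. \<sigma> permutes UNIV} - {\<sigma>. \<sigma> permutes - X}. ?F \<sigma> = 0"
      proof
        fix \<sigma> :: "'n \<Rightarrow> 'n" assume "\<sigma> \<in> {\<sigma>. \<sigma> permutes UNIV} - {\<sigma>. \<sigma> permutes - X}"
        then obtain k where "k \<in> X" "\<sigma> k \<noteq> k"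
          by (auto simp: permutes_def)
        then have "\<exists>k\<in>X. (mat x :: complex ^ 'n ^ 'n) $ k $ \<sigma> k = 0"
          by (intro bexI[of _ k]) (auto simp: mat_def)
        then have "(\<Prod>k\<in>X. (mat x :: complex ^ 'n ^ 'n) $ k $ \<sigma> k) = 0"
          by simp
        then show "?F \<sigma> = 0"
          by simp
      qed
    qed (auto intro: permutes_subset)
    also have "\<dots> = (- x) ^ card X * principal_minor A (- X)"
      unfolding principal_minor_def sum_distrib_left
    proof (rule sum.cong)
      fix \<sigma> :: "'n \<Rightarrow> 'n" assume "\<sigma> \<in> {\<sigma>. \<sigma> permutes - X}"
      then have "(\<Prod>k\<in>X. (mat x :: complex ^ 'n ^ 'n) $ k $ \<sigma> k) = (\<Prod>k\<in>X. x)"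
        by (intro prod.cong) (auto simp: mat_def permutes_def)
      then show "?F \<sigma> = (- x) ^ card X * (of_int (sign \<sigma>) * (\<Prod>k\<in>- X. A $ k $ \<sigma> k))"
        by (simp add: Compl_eq_Diff_UNIV power_minus[of x] mult_ac)
    qed simp
    finally show ?thesis .
  qed
  have "det (A - mat x) = (\<Sum>X\<in>UNIV. (- x) ^ card X * principal_minor A (- X))"
    unfolding det_def vector_minus_component prod_diff_conv_sum[OF finite] Pow_UNIV sum_distrib_left
    by (subst sum.swap) (simp add: inner)
  also have "\<dots> = (\<Sum>i\<le>CARD('n). \<Sum>X | X \<in> UNIV \<and> card X = i. (- x) ^ card X * principal_minor A (- X))"
    by (rule sum.group[symmetric]) (auto simp: card_mono)
  also have "\<dots> = (\<Sum>i\<le>CARD('n). (- 1) ^ i * minor_sum A (CARD('n) - i) * x ^ i)"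
  proof (rule sum.cong)
    fix i assume i: "i \<in> {..CARD('n)}"
    have "(\<Sum>X | X \<in> UNIV \<and> card X = i. (- x) ^ card X * principal_minor A (- X)) =
        (- x) ^ i * (\<Sum>X | card X = i. principal_minor A (- X))"
      by (simp add: sum_distrib_left)
    also have "(\<Sum>X | card X = i. principal_minor A (- X)) = minor_sum A (CARD('n) - i)"
      unfolding minor_sum_def
      by (rule sum.reindex_bij_witness[of _ uminus uminus])
        (use i in \<open>auto simp: Compl_eq_Diff_UNIV card_Diff_subset\<close>)
    finally show "(\<Sum>X | X \<in> UNIV \<and> card X = i. (- x) ^ card X * principal_minor A (- X)) =
        (- 1) ^ i * minor_sum A (CARD('n) - i) * x ^ i"
      by (simp add: power_minus[of x] mult_ac)
  qed simp
  finally show ?thesis .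
qed

section \<open>Signed sums of trace products\<close>

text \<open>Relabelling \<open>S\<close> along the injection \<open>g\<close> matches the
  permutations of \<open>S\<close> with those of its image and keeps signs, so the sum is a Leibniz
  formula.\<close>

lemma sum_sign_prod_inj:
  fixes A :: "complex ^ 'n ^ 'n"
  assumes "finite S" "inj_on g S"
  shows "(\<Sum>\<sigma> | \<sigma> permutes S. of_int (sign \<sigma>) * (\<Prod>k\<in>S. A $ g k $ g (\<sigma> k))) =
    principal_minor A (g ` S)"
proof -
  define h where "h = inv_into S g"
  have bij: "bij_betw g S (g ` S)" "bij_betw h (g ` S) S"
    using assms(2) by (auto simp: h_def bij_betw_inv_into bij_betw_imageI)
  have hg: "h (g k) = k" if "k \<in> S" for k
    using assms(2) that by (simp add: h_def)
  show ?thesis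
    unfolding principal_minor_def
  proof (rule sum.reindex_bij_witness[of _ "map_permutation (g ` S) h" "map_permutation S g"])
    fix \<sigma> assume "\<sigma> \<in> {\<sigma>. \<sigma> permutes S}"
    then have \<sigma>: "\<sigma> permutes S" by simp
    show "map_permutation (g ` S) h (map_permutation S g \<sigma>) = \<sigma>"
      by (rule map_permutation_compose_inv[OF bij(1) \<sigma>]) (rule hg)
    show "map_permutation S g \<sigma> \<in> {\<sigma>. \<sigma> permutes g ` S}"
      using map_permutation_permutes[OF bij(1) \<sigma>] by simp
    show "of_int (sign (map_permutation S g \<sigma>)) * (\<Prod>k\<in>g ` S. A $ k $ map_permutation S g \<sigma> k) =
        of_int (sign \<sigma>) * (\<Prod>k\<in>S. A $ g k $ g (\<sigma> k))"
      using assms \<sigma> by (simp add: sign_map_permutation prod.reindex map_permutation_apply)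
  next
    fix \<tau> assume "\<tau> \<in> {\<sigma>. \<sigma> permutes g ` S}"
    then have \<tau>: "\<tau> permutes g ` S" by simp
    show "map_permutation S g (map_permutation (g ` S) h \<tau>) = \<tau>"
      by (rule map_permutation_compose_inv[OF bij(2) \<tau>]) (auto simp: hg)
    show "map_permutation (g ` S) h \<tau> \<in> {\<sigma>. \<sigma> permutes S}"
      using map_permutation_permutes[OF bij(2) \<tau>] by simp
  qed
qed

text \<open>A determinant with two equal columns: swapping two points with the same index negates
  each term, so the sum is its own negative.\<close>

lemma sum_sign_prod_not_inj:
  fixes A :: "complex ^ 'n ^ 'n"
  assumes "finite S" "\<not> inj_on g S"
  shows "(\<Sum>\<sigma> | \<sigma> permutes S. of_int (sign \<sigma>) * (\<Prod>k\<in>S. A $ g k $ g (\<sigma> k))) = 0"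
    (is "sum ?F _ = 0")
proof -
  obtain p q where pq: "p \<in> S" "q \<in> S" "p \<noteq> q" "g p = g q"
    using assms(2) by (auto simp: inj_on_def)
  define \<tau> where "\<tau> = Transposition.transpose p q"
  have \<tau>: "\<tau> permutes S" "\<tau> \<circ> \<tau> = id" "g (\<tau> x) = g x" "sign \<tau> = - 1" "permutation \<tau>" for x
    using pq by (auto simp: \<tau>_def permutes_swap_id Transposition.transpose_def sign_swap_id
        permutation_swap_id)
  have "sum ?F {\<sigma>. \<sigma> permutes S} = (\<Sum>\<sigma> | \<sigma> permutes S. - ?F \<sigma>)"
  proof (rule sum.reindex_bij_witness[of _ "\<lambda>\<sigma>. \<tau> \<circ> \<sigma>" "\<lambda>\<sigma>. \<tau> \<circ> \<sigma>"])
    fix \<sigma> assume "\<sigma> \<in> {\<sigma>. \<sigma> permutes S}"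
    then have \<sigma>: "\<sigma> permutes S" "permutation \<sigma>"
      using assms(1) permutation_permutes by blast+
    show "- ?F (\<tau> \<circ> \<sigma>) = ?F \<sigma>"
      using \<sigma> \<tau> by (simp add: sign_compose)
  qed (use \<tau> in \<open>auto simp: permutes_compose o_assoc\<close>)
  then show ?thesis
    by (simp add: sum_negf)
qed

lemma card_bijections_PiE:
  assumes "finite S" "finite W" "card W = card S"
  shows "card {g \<in> S \<rightarrow>\<^sub>E UNIV. inj_on g S \<and> g ` S = W} = fact (card S)"
proof -
  have "{g \<in> S \<rightarrow>\<^sub>E UNIV. inj_on g S \<and> g ` S = W} = {g \<in> S \<rightarrow>\<^sub>E W. inj_on g S}"
  proof -
    have "inj_on g S \<and> g ` S = W \<longleftrightarrow> inj_on g S \<and> g ` S \<subseteq> W" for g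
      using card_subset_eq[OF assms(2), of "g ` S"] assms(3) by (auto simp: card_image)
    then show ?thesis
      by (auto simp: PiE_iff)
  qed
  then show ?thesis
    using card_inj_on_subset_funcset[OF assms(1,2) order_refl] assms(3)
    by (simp add: fact_prod_rev)
qed

text \<open>Each product of traces is expanded over the assignments \<open>g\<close> of indices to
  points. After exchanging the sums, only injective \<open>g\<close> survive, and each image
  \<open>W\<close> arises from \<open>fact (card S)\<close> of them.\<close>

lemma sum_sign_prod_trace:
  fixes A :: "complex ^ 'n ^ 'n"
  assumes "finite S"
  shows "(\<Sum>\<sigma> | \<sigma> permutes S. of_int (sign \<sigma>) * (\<Prod>c\<in>orbit \<sigma> ` S. trace (matrix_power A (card c)))) =
    fact (card S) * minor_sum A (card S)"
proof -
  define P where "P = (S \<rightarrow>\<^sub>E (UNIV :: 'n set))"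
  define J where "J = {g \<in> P. inj_on g S}"
  have fin: "finite P"
    unfolding P_def using assms by (intro finite_PiE) auto
  have "(\<Sum>\<sigma> | \<sigma> permutes S. of_int (sign \<sigma>) * (\<Prod>c\<in>orbit \<sigma> ` S. trace (matrix_power A (card c)))) =
      (\<Sum>\<sigma> | \<sigma> permutes S. of_int (sign \<sigma>) * (\<Sum>g\<in>P. \<Prod>k\<in>S. A $ g k $ g (\<sigma> k)))"
    unfolding P_def using assms by (intro sum.cong refl) (simp add: sum_prod_permutation)
  also have "\<dots> = (\<Sum>g\<in>P. \<Sum>\<sigma> | \<sigma> permutes S. of_int (sign \<sigma>) * (\<Prod>k\<in>S. A $ g k $ g (\<sigma> k)))"
    unfolding sum_distrib_left by (rule sum.swap)
  also have "\<dots> = (\<Sum>g\<in>J. principal_minor A (g ` S))"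
    using fin assms sum_sign_prod_inj[OF assms] sum_sign_prod_not_inj[OF assms]
    by (intro sum.mono_neutral_cong_right) (auto simp: J_def)
  also have "\<dots> = (\<Sum>W | card W = card S. \<Sum>g | g \<in> J \<and> g ` S = W. principal_minor A (g ` S))"
    by (rule sum.group[symmetric]) (use fin in \<open>auto simp: J_def card_image\<close>)
  also have "\<dots> = (\<Sum>W | card W = card S. fact (card S) * principal_minor A W)"
  proof (rule sum.cong)
    fix W :: "'n set" assume W: "W \<in> {W. card W = card S}"
    have "(\<Sum>g | g \<in> J \<and> g ` S = W. principal_minor A (g ` S)) =
        (\<Sum>g | g \<in> J \<and> g ` S = W. principal_minor A W)"
      by (rule sum.cong) auto
    also have "\<dots> = of_nat (card {g \<in> J. g ` S = W}) * principal_minor A W"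
      by simp
    also have "card {g \<in> J. g ` S = W} = fact (card S)"
      using card_bijections_PiE[OF assms finite, of W] W by (simp add: J_def P_def conj_assoc)
    finally show "(\<Sum>g | g \<in> J \<and> g ` S = W. principal_minor A (g ` S)) =
        fact (card S) * principal_minor A W"
      by simp
  qed simp
  finally show ?thesis
    by (simp add: minor_sum_def sum_distrib_left)
qed

section \<open>The recursion for the coefficients\<close>

text \<open>Generalizes \<open>kappa\<close> to any marked point \<open>a\<close> and to sets whose
  size is independent of the dimension, because contraction removes a letter and moves the
  mark.\<close>

definition kappa_on :: "complex ^ 'n ^ 'n \<Rightarrow> 'a set \<Rightarrow> 'a \<Rightarrow> nat \<Rightarrow> complex" where
  "kappa_on A S a i = (\<Sum>\<sigma> | \<sigma> permutes insert a S \<and> card (orbit \<sigma> a) = i + 1.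
     of_int (sign \<sigma>) *
     (\<Prod>c\<in>orbit \<sigma> ` insert a S - {orbit \<sigma> a}. trace (matrix_power A (card c))))"

text \<open>Splits the permutations by the image of \<open>a\<close>. If \<open>a\<close> is fixed,
  only \<open>i = 0\<close> counts and \<open>sum_sign_prod_trace\<close> applies; if the image is
  \<open>b\<close>, contraction flips the sign, and \<open>b\<close> marks a cycle one
  shorter.\<close>

lemma kappa_on_rec:
  fixes A :: "complex ^ 'n ^ 'n"
  assumes "finite S" "a \<notin> S"
  shows "kappa_on A S a i =
    (if i = 0 then fact (card S) * minor_sum A (card S) else 0) -
    (\<Sum>b\<in>S. if i = 0 then 0 else kappa_on A (S - {b}) b (i - 1))"
proof -
  define P where "P \<sigma> = of_int (sign \<sigma>) *
    (\<Prod>c\<in>orbit \<sigma> ` insert a S - {orbit \<sigma> a}. trace (matrix_power A (card c)))" for \<sigma>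
  define F where "F \<sigma> = (if card (orbit \<sigma> a) = i + 1 then P \<sigma> else 0)" for \<sigma>
  have "kappa_on A S a i = (\<Sum>\<sigma> | \<sigma> permutes insert a S. F \<sigma>)"
    unfolding kappa_on_def F_def P_def using assms(1)
    by (subst sum.inter_filter[symmetric]) (auto simp: finite_permutations)
  also have "\<dots> = (\<Sum>\<rho> | \<rho> permutes S. F \<rho>) +
      (\<Sum>b\<in>S. \<Sum>\<rho> | \<rho> permutes S. F (Transposition.transpose a b \<circ> \<rho>))"
    using assms by (simp add: sum_over_permutations_insert)
  also have "(\<Sum>\<rho> | \<rho> permutes S. F \<rho>) =
      (if i = 0 then fact (card S) * minor_sum A (card S) else 0)"
  proof -
    have F: "F \<rho> = (if i = 0 then of_int (sign \<rho>) *
        (\<Prod>c\<in>orbit \<rho> ` S. trace (matrix_power A (card c))) else 0)" if "\<rho> permutes S" for \<rho>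
    proof -
      have "orbit \<rho> a = {a}"
        using permutes_not_in[OF that assms(2)] by (simp add: orbit_eq_singleton_iff)
      then show ?thesis
        unfolding F_def P_def other_orbits_fixed[OF that assms(2)] by simp
    qed
    have "(\<Sum>\<rho> | \<rho> permutes S. F \<rho>) = (\<Sum>\<rho> | \<rho> permutes S. if i = 0 then of_int (sign \<rho>) *
        (\<Prod>c\<in>orbit \<rho> ` S. trace (matrix_power A (card c))) else 0)"
      using F by (intro sum.cong) auto
    then show ?thesis
      using sum_sign_prod_trace[OF assms(1), of A] by simp
  qed
  also have "(\<Sum>b\<in>S. \<Sum>\<rho> | \<rho> permutes S. F (Transposition.transpose a b \<circ> \<rho>)) =
      (\<Sum>b\<in>S. - (if i = 0 then 0 else kappa_on A (S - {b}) b (i - 1)))"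
  proof (rule sum.cong)
    fix b assume b: "b \<in> S"
    have F: "F (Transposition.transpose a b \<circ> \<rho>) =
        - (if card (orbit \<rho> b) = i then of_int (sign \<rho>) *
          (\<Prod>c\<in>orbit \<rho> ` S - {orbit \<rho> b}. trace (matrix_power A (card c))) else 0)"
      if "\<rho> permutes S" for \<rho>
    proof -
      note c = that assms b
      show ?thesis
        unfolding F_def P_def other_orbits_transpose_comp[OF c] sign_transpose_comp[OF c]
          card_orbit_transpose_comp_self[OF c] by simp
    qed
    have pos: "card (orbit \<rho> b) > 0" if "\<rho> permutes S" for \<rho>
      using permutes_orbit_subset[OF that b] assms(1) finite_subset orbit_nonempty[of \<rho> b]
      by (fastforce simp: card_gt_0_iff)
    have "(\<Sum>\<rho> | \<rho> permutes S. F (Transposition.transpose a b \<circ> \<rho>)) =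
        - (\<Sum>\<rho> | \<rho> permutes S. if card (orbit \<rho> b) = i then of_int (sign \<rho>) *
          (\<Prod>c\<in>orbit \<rho> ` S - {orbit \<rho> b}. trace (matrix_power A (card c))) else 0)"
      unfolding sum_negf[symmetric] using F by (intro sum.cong) auto
    also have "\<dots> = - (\<Sum>\<rho> | \<rho> permutes S \<and> card (orbit \<rho> b) = i. of_int (sign \<rho>) *
          (\<Prod>c\<in>orbit \<rho> ` S - {orbit \<rho> b}. trace (matrix_power A (card c))))"
      using assms(1) by (subst sum.inter_filter[symmetric]) (auto simp: finite_permutations)
    \<comment> \<open>No orbit has size \<open>0\<close>, so the sum vanishes for
      \<open>i = 0\<close>; otherwise \<open>(i - 1) + 1 = i\<close> and
      \<open>insert b (S - {b})\<close> is \<open>S\<close>.\<close>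
    also have "\<dots> = - (if i = 0 then 0 else kappa_on A (S - {b}) b (i - 1))"
      using b pos by (cases i) (force simp: kappa_on_def insert_absorb intro!: sum.neutral)+
    finally show "(\<Sum>\<rho> | \<rho> permutes S. F (Transposition.transpose a b \<circ> \<rho>)) =
        - (if i = 0 then 0 else kappa_on A (S - {b}) b (i - 1))" .
  qed simp
  finally show ?thesis
    by (simp add: sum_negf)
qed

text \<open>Each unrolling of the recursion gives a factor \<open>-1\<close> and
  \<open>card S\<close> equal summands, and that count raises the factorial of the smaller set to
  \<open>fact (card S)\<close>.\<close>

lemma kappa_on_eq:
  fixes A :: "complex ^ 'n ^ 'n"
  assumes "finite S" "a \<notin> S" "i \<le> card S"
  shows "kappa_on A S a i = (- 1) ^ i * fact (card S) * minor_sum A (card S - i)"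
  using assms
proof (induction i arbitrary: S a)
  case 0
  then show ?case
    by (simp add: kappa_on_rec[of S a A 0])
next
  case (Suc i)
  then obtain m where m: "card S = Suc m" "i \<le> m"
    by (cases "card S") auto
  have "kappa_on A S a (Suc i) = - (\<Sum>b\<in>S. kappa_on A (S - {b}) b i)"
    using Suc.prems by (simp add: kappa_on_rec[of S a A "Suc i"])
  also have "\<dots> = - (\<Sum>b\<in>S. (- 1) ^ i * fact m * minor_sum A (m - i))"
    using Suc.IH Suc.prems m by simp
  finally show ?case
    using m by (simp add: algebra_simps)
qed

section \<open>Expansion of the closed-up diagram\<close>

lemma matrix_vector_mult_axis: "(A *v axis j 1) $ i = A $ i $ j"
  for A :: "complex ^ 'n ^ 'n"
  by (simp add: matrix_vector_mult_def axis_def if_distrib[of "(*) _"] cong: if_cong)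

lemma atLeastAtMost_Suc_insert: "{1..n+1} = insert 1 {2..n+1}" for n :: nat
  by auto

text \<open>Factor \<open>k\<close> of the permuted tensor is the old factor
  \<open>\<sigma> k\<close>: the vector \<open>v\<close> if \<open>\<sigma> k = 1\<close>, where the
  identity acts, and otherwise column \<open>g (\<sigma> k)\<close> of \<open>A\<close>. These are
  the factors of \<open>walk_sum\<close> with open point \<open>1\<close>.\<close>

lemma ptr_permute_tensor:
  fixes A :: "complex ^ 'n ^ 'n"
  assumes \<sigma>: "\<sigma> permutes {1..CARD('n)+1}"
  shows "ptr CARD('n) (permute_tensor \<sigma> \<circ> id_tensor_power A) v =
    (\<Prod>d\<in>other_cycles (CARD('n)+1) \<sigma>. trace (matrix_power A (card d))) *s
      (matrix_power A (card (orbit \<sigma> 1) - 1) *v v)"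
proof -
  let ?n = "CARD('n)"
  have \<sigma>': "\<sigma> permutes insert 1 {2..?n+1}"
    using \<sigma> unfolding atLeastAtMost_Suc_insert .
  have "ptr ?n (permute_tensor \<sigma> \<circ> id_tensor_power A) v $ i = walk_sum A \<sigma> {2..?n+1} 1 v i" for i
    unfolding ptr_def id_tensor_power_def o_def tensor_map_pure permute_tensor_pure[OF \<sigma>]
      walk_sum_def vec_lambda_beta
  proof (rule sum.cong)
    fix g :: "nat \<Rightarrow> 'n" assume g: "g \<in> {2..?n+1} \<rightarrow>\<^sub>E UNIV"
    then have "g(1 := i) \<in> multi_indices (?n+1)"
      unfolding multi_indices_def atLeastAtMost_Suc_insert by (intro PiE_fun_upd) auto
    then show "pure_tensor (?n+1) (\<lambda>k. (if \<sigma> k = 1 then mat 1 else A) *v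
          (if \<sigma> k = 1 then v else axis (g (\<sigma> k)) 1)) (g(1 := i)) =
        (\<Prod>k\<in>insert 1 {2..?n+1}. if \<sigma> k = 1 then v $ (g(1 := i)) k
          else A $ (g(1 := i)) k $ (g(1 := i)) (\<sigma> k))"
      unfolding pure_tensor_def atLeastAtMost_Suc_insert
      by (simp add: matrix_vector_mult_axis del: prod.insert)
        (intro prod.cong refl; simp add: matrix_vector_mult_axis)
  qed simp
  then show ?thesis
    using walk_sum_eq[of "{2..?n+1}" 1 \<sigma> A v] \<sigma>'
    unfolding other_cycles_def atLeastAtMost_Suc_insert by (simp add: vec_eq_iff)
qed

lemma kappa_eq_kappa_on: "kappa A i = kappa_on A {2..CARD('n)+1} 1 i"
  for A :: "complex ^ 'n ^ 'n"
  unfolding kappa_def kappa_on_def other_cycles_def atLeastAtMost_Suc_insert ..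

lemma ptr_Alt:
  fixes A :: "complex ^ 'n ^ 'n"
  shows "ptr CARD('n) (Alt (CARD('n)+1) \<circ> id_tensor_power A) v =
    (\<Sum>i\<le>CARD('n). kappa A i *s (matrix_power A i *v v))"
proof -
  let ?n = "CARD('n)"
  let ?S = "{1..?n+1}"
  let ?P = "\<lambda>\<sigma>. \<Prod>d\<in>other_cycles (?n+1) \<sigma>. trace (matrix_power A (card d))"
  have "ptr ?n (Alt (?n+1) \<circ> id_tensor_power A) v =
      (\<Sum>\<sigma> | \<sigma> permutes ?S. of_int (sign \<sigma>) *s ptr ?n (permute_tensor \<sigma> \<circ> id_tensor_power A) v)"
    unfolding vec_eq_iff ptr_def Alt_def o_def
    by (simp add: sum_distrib_left) (intro allI sum.swap)
  \<comment> \<open>By \<open>ptr_permute_tensor\<close> the length of the cycle of \<open>1\<close>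
    determines the power of \<open>A\<close>, hence the grouping.\<close>
  also have "\<dots> = (\<Sum>i\<le>?n. \<Sum>\<sigma> | \<sigma> \<in> {\<sigma>. \<sigma> permutes ?S} \<and> card (orbit \<sigma> 1) - 1 = i.
      of_int (sign \<sigma>) *s ptr ?n (permute_tensor \<sigma> \<circ> id_tensor_power A) v)"
  proof (rule sum.group[symmetric])
    show "(\<lambda>\<sigma>. card (orbit \<sigma> 1) - 1) ` {\<sigma>. \<sigma> permutes ?S} \<subseteq> {..?n}"
    proof clarify
      fix \<sigma> assume "\<sigma> permutes ?S"
      then have "card (orbit \<sigma> 1) \<le> card ?S"
        by (intro card_mono permutes_orbit_subset) auto
      then show "card (orbit \<sigma> 1) - 1 \<le> ?n"
        by simp
    qed
  qed (auto simp: finite_permutations)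
  also have "\<dots> = (\<Sum>i\<le>?n. kappa A i *s (matrix_power A i *v v))"
  proof (rule sum.cong)
    fix i
    \<comment> \<open>The orbit is nonempty, so \<open>card (orbit \<sigma> 1) - 1 = i\<close>
      agrees with the condition in \<open>kappa\<close> also for \<open>i = 0\<close>.\<close>
    have pos: "card (orbit \<sigma> 1) > 0" if "\<sigma> permutes ?S" for \<sigma>
      using permutes_orbit_subset[OF that, of 1] finite_subset[of "orbit \<sigma> 1" ?S] orbit_nonempty[of \<sigma> 1]
      by (auto simp: card_gt_0_iff)
    have "(\<Sum>\<sigma> | \<sigma> \<in> {\<sigma>. \<sigma> permutes ?S} \<and> card (orbit \<sigma> 1) - 1 = i.
        of_int (sign \<sigma>) *s ptr ?n (permute_tensor \<sigma> \<circ> id_tensor_power A) v) =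
      (\<Sum>\<sigma> | \<sigma> permutes ?S \<and> card (orbit \<sigma> 1) = i + 1.
        (of_int (sign \<sigma>) * ?P \<sigma>) *s (matrix_power A i *v v))"
      using pos by (intro sum.cong) (force simp: ptr_permute_tensor)+
    then show "(\<Sum>\<sigma> | \<sigma> \<in> {\<sigma>. \<sigma> permutes ?S} \<and> card (orbit \<sigma> 1) - 1 = i.
        of_int (sign \<sigma>) *s ptr ?n (permute_tensor \<sigma> \<circ> id_tensor_power A) v) =
        kappa A i *s (matrix_power A i *v v)"
      by (simp add: kappa_def vec_eq_iff sum_distrib_right)
  qed simp
  finally show ?thesis .
qed

theorem proposition7p2:
  fixes A :: "complex ^ 'n ^ 'n" and c :: "nat \<Rightarrow> complex"
  assumes charpoly: "\<And>x. det (A - mat x) = (\<Sum>i\<le>CARD('n). c i * x ^ i)"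
  shows "(\<forall>\<sigma> i v. \<sigma> permutes {1..CARD('n)+1} \<and> card (orbit \<sigma> 1) = i + 1 \<longrightarrow>
            of_int (sign \<sigma>) *s ptr (CARD('n)) (permute_tensor \<sigma> \<circ> id_tensor_power A) v =
              (of_int (sign \<sigma>) *
                (\<Prod>d\<in>other_cycles (CARD('n)+1) \<sigma>. trace (matrix_power A (card d))))
              *s (matrix_power A i *v v))
       \<and> (\<forall>v. ptr (CARD('n)) (Alt (CARD('n)+1) \<circ> id_tensor_power A) v =
            (\<Sum>i\<le>CARD('n). kappa A i *s (matrix_power A i *v v)))
       \<and> (\<forall>i\<le>CARD('n). kappa A i = fact (CARD('n)) * c i)"
proof -
  have "\<forall>x. (\<Sum>i\<le>CARD('n). c i * x ^ i) =
      (\<Sum>i\<le>CARD('n). (- 1) ^ i * minor_sum A (CARD('n) - i) * x ^ i)"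
    unfolding charpoly[symmetric] det_sub_mat by simp
  \<comment> \<open>A complex polynomial function determines its coefficients.\<close>
  then have c: "c i = (- 1) ^ i * minor_sum A (CARD('n) - i)" if "i \<le> CARD('n)" for i
    using that unfolding polyfun_eq_coeffs by blast
  show ?thesis
    using ptr_Alt[of A] by (simp add: ptr_permute_tensor c kappa_eq_kappa_on kappa_on_eq)
qed

end
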